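(* For all real numbers $a, b$ with $a > b > 0$ and every non-negative integer $n$, $$ \int_0^1 \frac{x^n (1-x)^n}{\bigl((x+a)(x+b)\bigr)^{n+1}} \, dx \;=\; \int_0^1 \frac{x^n (1-x)^n}{\bigl((a-b)x + (a+1)b\bigr)^{n+1}} \, dx . $$ *)

theory Defs
  imports "HOL-Analysis.Analysis"
begin

end

(* The substitution y = (1 + a) x / (x + a) is the Moebius map fixing 0 and 1 and sending -a to
   infinity; equality of cross ratios forces it to send -b to the pole -(a + 1) b / (a - b) of the
   right-hand integrand, so it turns the right-hand integral into the left-hand one. *)
theory Submission
  imports Defs
begin

theorem mainTheorem1:
  fixes a b :: real and n :: nat
  assumes "a > b" and "b > 0"
  shows "integral {0..1} (\<lambda>x::real. x ^ n * (1 - x) ^ n / ((x + a) * (x + b)) ^ (n + 1))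
       = integral {0..1} (\<lambda>x::real. x ^ n * (1 - x) ^ n / ((a - b) * x + (a + 1) * b) ^ (n + 1))"
proof -
  define f where "f = (\<lambda>x::real. x ^ n * (1 - x) ^ n / ((a - b) * x + (a + 1) * b) ^ (n + 1))"
  define g where "g = (\<lambda>x::real. (1 + a) * x / (x + a))"
  define g' where "g' = (\<lambda>x::real. (1 + a) * a / (x + a) ^ 2)"
  have a: "a > 0" using assms by simp
  have pos: "(a - b) * y + (a + 1) * b > 0" if "y \<ge> 0" for y
    using assms a that by (intro add_nonneg_pos mult_nonneg_nonneg mult_pos_pos) auto
  \<comment> \<open>After clearing the positive denominator, the upper bound becomes
    \<open>a * x\<close> \<le> \<open>a\<close>.\<close>
  have g_range: "g ` {0..1} \<subseteq> {0..1}"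
    using a by (auto simp: g_def divide_simps algebra_simps)
  have f_cont: "continuous_on {0..1} f"
    unfolding f_def using pos by (intro continuous_intros) (auto simp: less_imp_neq[symmetric])
  have g_deriv: "(g has_field_derivative g' x) (at x within {0..1})" if "x \<in> {0..1}" for x
    unfolding g_def g'_def using a that
    by (auto intro!: derivative_eq_intros simp: divide_simps power2_eq_square algebra_simps)
  have pullback: "g' x *\<^sub>R f (g x) = x ^ n * (1 - x) ^ n / ((x + a) * (x + b)) ^ (n + 1)"
    if x: "x \<in> {0..1}" for x
  proof -
    \<comment> \<open>The determinant of the Moebius map \<open>g\<close>, hence the numerator of
      \<open>g'\<close>.\<close>
    define c where "c = (1 + a) * a"
    define p q r where "p = x + a" and "q = x + b" and "r = x * (1 - x)"
    have nz: "c \<noteq> 0" "p \<noteq> 0" "q \<noteq> 0"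
      using a assms x by (auto simp: c_def p_def q_def)
    \<comment> \<open>Here \<open>1 - g x = a * (1 - x) / p\<close>.\<close>
    have prod: "g x * (1 - g x) = c * r / p ^ 2"
      using nz by (simp add: g_def c_def p_def r_def field_simps power2_eq_square)
    \<comment> \<open>Over the denominator \<open>p\<close>, the factor \<open>a + 1\<close> comes
      out and the terms in \<open>b * x\<close> cancel, leaving \<open>a * (x + b)\<close>.\<close>
    have denom: "(a - b) * g x + (a + 1) * b = c * q / p"
      using nz by (simp add: g_def c_def p_def q_def field_simps)
    have "g' x *\<^sub>R f (g x) = c / p ^ 2 * ((c * r / p ^ 2) ^ n / (c * q / p) ^ (n + 1))"
      by (simp add: f_def g'_def c_def[symmetric] p_def[symmetric] denom prod[symmetric]
            power_mult_distrib)
    \<comment> \<open>Count exponents: \<open>c\<close> has 1 + n - (n + 1) = 0, and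
      \<open>p\<close> has -2 - 2n + (n + 1) = -(n + 1), matching \<open>q\<close>.\<close>
    also have "\<dots> = r ^ n / (p * q) ^ (n + 1)"
      using nz by (simp add: power_mult_distrib power_divide field_simps power2_eq_square)
    finally show ?thesis
      by (simp add: p_def q_def r_def power_mult_distrib)
  qed
  \<comment> \<open>In the substitution rule, \<open>c\<close> and \<open>d\<close> bound an
    interval that contains the image of \<open>g\<close> and on which \<open>f\<close> is
    continuous.\<close>
  have "((\<lambda>x. g' x *\<^sub>R f (g x)) has_integral integral {g 0..g 1} f) {0..1}"
    using a g_range f_cont g_deriv
    by (intro has_integral_substitution[where c = 0 and d = 1]) (auto simp: g_def)
  moreover have "g 0 = 0" "g 1 = 1"
    using a by (auto simp: g_def)
  ultimately have "((\<lambda>x. g' x *\<^sub>R f (g x)) has_integral integral {0..1} f) {0..1}"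
    by simp
  then have "integral {0..1} (\<lambda>x. g' x *\<^sub>R f (g x)) = integral {0..1} f"
    by (rule integral_unique)
  moreover have "integral {0..1} (\<lambda>x. g' x *\<^sub>R f (g x))
      = integral {0..1} (\<lambda>x. x ^ n * (1 - x) ^ n / ((x + a) * (x + b)) ^ (n + 1))"
    by (intro integral_cong pullback)
  ultimately show ?thesis
    by (simp add: f_def)
qed

end
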